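(* Let $\mathcal{M}=(E,\mathcal{I})$ be a matroid on a finite set $E$, let $X\subseteq\{0,1\}^E$ be the set of incidence vectors of bases of $\mathcal{M}$, and let $\mathcal{C}$ be the class of non-decreasing cost functions $c\colon X\to\mathbb{R}$. Then for $S\subseteq E$ the following are equivalent: (i) $S$ is controlling for $(X,\mathcal{C})$; (ii) $S$ is identifying for $X$; (iii) $|S\cap C|\ge |C|-1$ for every circuit $C$ of $\mathcal{M}$.
   Context: A set $S \subseteq E$ is controlling for $(X,\mathcal{C})$ if for every $c \in \mathcal{C}$ and every $x^* \in X$ there is $\gamma \in \mathbb{R}^S$ such that $\min_{x \in X}\{c(x) + \sum_{e\in S}\gamma_e x_e\}$ exists and is attained at $x^*$. A set $S$ is identifying for $X$ if for all $x\ne x'$ in $X$ there is $e\in S$ with $x_e\ne x'_e$. A circuit is an inclusion-wise minimal dependent set of $\mathcal{M}$. Non-decreasing means $c(x)\le c(y)$ whenever $x\le y$ componentwise. *)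

theory Defs
  imports Complex_Main "HOL-Library.FuncSet" "HOL-Library.Indicator_Function"
begin

locale matroid =
  fixes E :: "'a set" and I :: "'a set set"
  assumes finite_ground: "finite E"
    and indep_subset_ground: "A \<in> I \<Longrightarrow> A \<subseteq> E"
    and indep_empty: "{} \<in> I"
    and indep_subset: "A \<in> I \<Longrightarrow> B \<subseteq> A \<Longrightarrow> B \<in> I"
    and augment: "A \<in> I \<Longrightarrow> B \<in> I \<Longrightarrow> card A < card B \<Longrightarrow> \<exists>e \<in> B - A. insert e A \<in> I"

definition basis :: "'a set set \<Rightarrow> 'a set \<Rightarrow> bool" where
  "basis I B \<longleftrightarrow> B \<in> I \<and> (\<forall>A \<in> I. B \<subseteq> A \<longrightarrow> A = B)"

definition dependent_set :: "'a set \<Rightarrow> 'a set set \<Rightarrow> 'a set \<Rightarrow> bool" where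
  "dependent_set E I D \<longleftrightarrow> D \<subseteq> E \<and> D \<notin> I"

definition circuit :: "'a set \<Rightarrow> 'a set set \<Rightarrow> 'a set \<Rightarrow> bool" where
  "circuit E I C \<longleftrightarrow> dependent_set E I C \<and> (\<forall>D. D \<subset> C \<longrightarrow> \<not> dependent_set E I D)"

text \<open>Elements of \<open>\<real>\<^sup>E\<close> are represented by extensional functions
  \<open>E \<rightarrow>\<^sub>E UNIV\<close>, so that equality of vectors is equality of the
  components indexed by \<open>E\<close>.\<close>

definition incidence_vector :: "'a set \<Rightarrow> 'a set \<Rightarrow> ('a \<Rightarrow> real)" where
  "incidence_vector E B = restrict (indicator B) E"

definition basis_vectors :: "'a set \<Rightarrow> 'a set set \<Rightarrow> ('a \<Rightarrow> real) set" where
  "basis_vectors E I = {incidence_vector E B | B. basis I B}"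

definition nondecreasing_costs ::
  "'a set \<Rightarrow> ('a \<Rightarrow> real) set \<Rightarrow> (('a \<Rightarrow> real) \<Rightarrow> real) set" where
  "nondecreasing_costs E X =
     {c \<in> X \<rightarrow>\<^sub>E UNIV. monotone_on X (\<lambda>x y. \<forall>e \<in> E. x e \<le> y e) (\<le>) c}"

definition controlling ::
  "('a \<Rightarrow> real) set \<Rightarrow> (('a \<Rightarrow> real) \<Rightarrow> real) set \<Rightarrow> 'a set \<Rightarrow> bool" where
  "controlling X \<C> S \<longleftrightarrow>
     (\<forall>c \<in> \<C>. \<forall>x' \<in> X. \<exists>\<gamma> \<in> S \<rightarrow>\<^sub>E (UNIV :: real set).
        is_arg_min (\<lambda>x. c x + (\<Sum>e \<in> S. \<gamma> e * x e)) (\<lambda>x. x \<in> X) x')"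

definition identifying :: "('a \<Rightarrow> real) set \<Rightarrow> 'a set \<Rightarrow> bool" where
  "identifying X S \<longleftrightarrow> (\<forall>x \<in> X. \<forall>x' \<in> X. x \<noteq> x' \<longrightarrow> (\<exists>e \<in> S. x e \<noteq> x' e))"

end

theory Submission imports Defs begin

text \<open>
  Bases form an antichain, so every cost function on \<open>X\<close> is non-decreasing. If \<open>S\<close>
  is identifying, a weight of large modulus on \<open>S\<close>, negative exactly on the support of
  \<open>x'\<close>, penalises every other vector enough to make \<open>x'\<close> optimal. If two vectors
  agree on \<open>S\<close>, a cost function that charges only one of them prevents that one from becoming
  optimal.

  A circuit with two elements \<open>e\<close>, \<open>f\<close> outside \<open>S\<close> yields two bases
  differing exactly in \<open>e\<close> and \<open>f\<close>. Conversely, if bases \<open>B\<close>,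
  \<open>B'\<close> agree on \<open>S\<close> and \<open>e \<in> B - B'\<close>, then a circuit in
  \<open>insert e B'\<close> contains \<open>e\<close> and some \<open>f \<in> B' - B\<close>, both outside \<open>S\<close>.
\<close>

section \<open>Controlling versus identifying sets of vectors\<close>

lemma finite_binary_identifying_imp_controlling:
  fixes X :: "('a \<Rightarrow> real) set"
  assumes finX: "finite X" and finS: "finite S"
    and binary: "\<And>x e. x \<in> X \<Longrightarrow> e \<in> S \<Longrightarrow> x e \<in> {0, 1}"
    and ident: "identifying X S"
  shows "controlling X \<C> S"
  unfolding controlling_def
proof (intro ballI)
  fix c :: "('a \<Rightarrow> real) \<Rightarrow> real" and x' assume x': "x' \<in> X"
  \<comment> \<open>The sum of all cost gaps to \<open>x'\<close> bounds each single gap and is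
    nonnegative.\<close>
  define M where "M = (\<Sum>x\<in>X. \<bar>c x' - c x\<bar>)"
  \<comment> \<open>The factor \<open>1 - 2 * x' e\<close> is -1 where \<open>x' e = 1\<close> and 1
    where \<open>x' e = 0\<close>, so each coordinate of \<open>S\<close> in which a vector differs
    from \<open>x'\<close> costs exactly \<open>M\<close>.\<close>
  define \<gamma> where "\<gamma> = restrict (\<lambda>e. M * (1 - 2 * x' e)) S"
  have M0: "M \<ge> 0" unfolding M_def by (simp add: sum_nonneg)
  have le: "c x' + (\<Sum>e\<in>S. \<gamma> e * x' e) \<le> c x + (\<Sum>e\<in>S. \<gamma> e * x e)" if x: "x \<in> X" for x
  proof (cases "x = x'")
    case False
    obtain d where d: "d \<in> S" "x d \<noteq> x' d"
      using ident x x' False unfolding identifying_def by blast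
    have term_eq: "\<gamma> e * x e - \<gamma> e * x' e = (if x e \<noteq> x' e then M else 0)" if "e \<in> S" for e
      using binary[OF x that] binary[OF x' that] that by (auto simp: \<gamma>_def)
    have "c x' - c x \<le> \<bar>c x' - c x\<bar>" by simp
    also have "\<dots> \<le> M"
      unfolding M_def by (rule member_le_sum) (use x finX in auto)
    also have "M = (if x d \<noteq> x' d then M else 0)" using d by simp
    also have "\<dots> \<le> (\<Sum>e\<in>S. if x e \<noteq> x' e then M else 0)"
      by (rule member_le_sum[where f = "\<lambda>e. if x e \<noteq> x' e then M else 0"])
        (use d finS M0 in auto)
    also have "\<dots> = (\<Sum>e\<in>S. \<gamma> e * x e - \<gamma> e * x' e)"
      by (rule sum.cong) (use term_eq in auto)
    also have "\<dots> = (\<Sum>e\<in>S. \<gamma> e * x e) - (\<Sum>e\<in>S. \<gamma> e * x' e)"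
      by (rule sum_subtractf)
    finally show ?thesis by linarith
  qed simp
  have "\<gamma> \<in> S \<rightarrow>\<^sub>E UNIV" by (simp add: \<gamma>_def)
  moreover have "is_arg_min (\<lambda>x. c x + (\<Sum>e\<in>S. \<gamma> e * x e)) (\<lambda>x. x \<in> X) x'"
    unfolding is_arg_min_def using x' le by (auto simp: not_less)
  ultimately show "\<exists>\<gamma> \<in> S \<rightarrow>\<^sub>E (UNIV :: real set).
      is_arg_min (\<lambda>x. c x + (\<Sum>e\<in>S. \<gamma> e * x e)) (\<lambda>x. x \<in> X) x'"
    by blast
qed

lemma controlling_all_costs_imp_identifying:
  assumes ctrl: "controlling X (X \<rightarrow>\<^sub>E UNIV) S"
  shows "identifying X S"
  unfolding identifying_def
proof (intro ballI impI, rule ccontr)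
  fix x x' assume x: "x \<in> X" and x': "x' \<in> X" and "x \<noteq> x'"
    and agree: "\<not> (\<exists>e\<in>S. x e \<noteq> x' e)"
  \<comment> \<open>Since \<open>x\<close> and \<open>x'\<close> get the same weighted sum for every
    \<gamma>, charging 1 at \<open>x'\<close> alone leaves \<open>x\<close> strictly
    cheaper.\<close>
  define c :: "('a \<Rightarrow> real) \<Rightarrow> real" where "c = restrict (indicator {x'}) X"
  have "c \<in> X \<rightarrow>\<^sub>E UNIV" by (simp add: c_def)
  then obtain \<gamma> where
    min: "is_arg_min (\<lambda>x. c x + (\<Sum>e\<in>S. \<gamma> e * x e)) (\<lambda>x. x \<in> X) x'"
    using ctrl x' unfolding controlling_def by blast
  have "(\<Sum>e\<in>S. \<gamma> e * x e) = (\<Sum>e\<in>S. \<gamma> e * x' e)"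
    by (rule sum.cong) (use agree in auto)
  moreover have "c x = 0" "c x' = 1" using x x' \<open>x \<noteq> x'\<close> by (auto simp: c_def)
  ultimately show False using min x unfolding is_arg_min_def by force
qed

text \<open>Comparable vectors of \<open>X\<close> are equal, so monotonicity only asks for
  \<open>c x \<le> c x\<close>.\<close>

lemma nondecreasing_costs_antichain:
  assumes "\<And>x y. x \<in> X \<Longrightarrow> y \<in> X \<Longrightarrow> \<forall>e\<in>E. x e \<le> y e \<Longrightarrow> x = y"
  shows "nondecreasing_costs E X = X \<rightarrow>\<^sub>E UNIV"
proof -
  have "monotone_on X (\<lambda>x y. \<forall>e\<in>E. x e \<le> y e) (\<le>) c" for c :: "_ \<Rightarrow> real"
    unfolding monotone_on_def using assms by (metis order_refl)
  then show ?thesis unfolding nondecreasing_costs_def by blast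
qed

section \<open>Bases and circuits of a matroid\<close>

context matroid
begin

lemma finite_indep: "A \<in> I \<Longrightarrow> finite A"
  using finite_ground indep_subset_ground finite_subset by metis

text \<open>Augmentation adds elements of \<open>B\<close> one at a time; induction is on the
  missing number of elements.\<close>

lemma extend_indep:
  assumes "A \<in> I" "B \<in> I" "card A \<le> card B"
  obtains D where "D \<in> I" "A \<subseteq> D" "D \<subseteq> A \<union> B" "card D = card B"
proof -
  have "\<exists>D\<in>I. A \<subseteq> D \<and> D \<subseteq> A \<union> B \<and> card D = card B"
    using assms
  proof (induction "card B - card A" arbitrary: A)
    case 0
    then show ?case by (intro bexI[of _ A]) auto
  next
    case (Suc n)
    then have "card A < card B" by simp
    then obtain e where e: "e \<in> B - A" "insert e A \<in> I" using augment Suc.prems by blast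
    have card: "card (insert e A) = Suc (card A)"
      using e finite_indep[OF \<open>A \<in> I\<close>] by simp
    then have "n = card B - card (insert e A)" "card (insert e A) \<le> card B"
      using Suc.hyps(2) \<open>card A < card B\<close> by simp_all
    from Suc.hyps(1)[OF this(1) e(2) \<open>B \<in> I\<close> this(2)] show ?case using e by blast
  qed
  then show ?thesis using that by blast
qed

text \<open>Augmentation would enlarge a maximal set smaller than some independent set. This lets
  later proofs recognise bases by counting.\<close>

lemma basis_iff_card_max: "basis I B \<longleftrightarrow> B \<in> I \<and> (\<forall>A\<in>I. card A \<le> card B)"
proof
  assume B: "basis I B"
  then have "card A \<le> card B" if "A \<in> I" for A
    using augment[of B A] that unfolding basis_def by (metis DiffD2 insertI1 not_le subset_insertI)
  with B show "B \<in> I \<and> (\<forall>A\<in>I. card A \<le> card B)" by (simp add: basis_def)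
next
  assume "B \<in> I \<and> (\<forall>A\<in>I. card A \<le> card B)"
  then show "basis I B" unfolding basis_def by (metis card_seteq finite_indep)
qed

lemma exists_basis: "\<exists>B. basis I B"
proof -
  have "finite I" using finite_ground indep_subset_ground
    by (meson Pow_iff finite_Pow_iff finite_subset subsetI)
  then show ?thesis
    using finite_has_maximal2[OF _ indep_empty] unfolding basis_def by metis
qed

lemma exists_circuit:
  assumes "D \<subseteq> E" "D \<notin> I"
  obtains C where "C \<subseteq> D" "circuit E I C"
proof -
  define \<D> where "\<D> = {C. C \<subseteq> D \<and> C \<notin> I}"
  have "finite \<D>"
    using finite_subset[OF assms(1) finite_ground] by (simp add: \<D>_def)
  moreover have "D \<in> \<D>" using assms by (simp add: \<D>_def)
  ultimately obtain C where C: "C \<in> \<D>" and min: "\<forall>C'\<in>\<D>. C' \<subseteq> C \<longrightarrow> C = C'"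
    using finite_has_minimal2[of \<D> D] by metis
  have "circuit E I C"
    unfolding circuit_def dependent_set_def using C min assms(1) by (auto simp: \<D>_def)
  with C that show ?thesis by (auto simp: \<D>_def)
qed

lemma circuit_diff_indep: "circuit E I C \<Longrightarrow> e \<in> C \<Longrightarrow> C - {e} \<in> I"
  unfolding circuit_def dependent_set_def by blast

text \<open>Extend \<open>C - {e}\<close> to a basis \<open>B\<close>, then extend
  \<open>C - {f}\<close> by elements of \<open>B\<close> to a basis \<open>B'\<close>. Neither
  contains all of \<open>C\<close>, so \<open>e\<close> is missing from \<open>B\<close> and
  \<open>f\<close> from \<open>B'\<close>; equal cardinality leaves no other difference.\<close>

lemma circuit_exchange_bases:
  assumes C: "circuit E I C" and e: "e \<in> C" and f: "f \<in> C" and "e \<noteq> f"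
  obtains B B' where "basis I B" "basis I B'" "e \<in> B' - B" "B' = insert e (B - {f})"
proof -
  have C_dep: "C \<notin> I" using C by (simp add: circuit_def dependent_set_def)
  obtain B0 where B0: "basis I B0" using exists_basis by blast
  obtain B where B: "B \<in> I" "C - {e} \<subseteq> B" "card B = card B0"
    using extend_indep[OF circuit_diff_indep[OF C e], of B0] B0 basis_iff_card_max
      circuit_diff_indep[OF C e] by metis
  have basisB: "basis I B" using B B0 by (simp add: basis_iff_card_max)
  have eB: "e \<notin> B" using B C_dep indep_subset by blast
  obtain B' where B': "B' \<in> I" "C - {f} \<subseteq> B'" "B' \<subseteq> (C - {f}) \<union> B" "card B' = card B"
    using extend_indep[OF circuit_diff_indep[OF C f] \<open>B \<in> I\<close>] basisB basis_iff_card_max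
      circuit_diff_indep[OF C f] by metis
  have basisB': "basis I B'" using B' basisB by (simp add: basis_iff_card_max)
  have "f \<notin> B'" using B' C_dep indep_subset by blast
  then have sub: "B' \<subseteq> insert e (B - {f})" using B' B by blast
  have fB: "f \<in> B" using B f \<open>e \<noteq> f\<close> by blast
  have finB: "finite B" using B finite_indep by blast
  have "card (insert e (B - {f})) = card B'"
    using B' eB fB finB card_Suc_Diff1[OF finB fB] by simp
  then have "B' = insert e (B - {f})"
    using sub finB by (intro card_subset_eq) auto
  then show ?thesis using that basisB basisB' eB by blast
qed

lemma bases_identified_iff_circuits:
  "(\<forall>B B'. basis I B \<longrightarrow> basis I B' \<longrightarrow> S \<inter> B = S \<inter> B' \<longrightarrow> B = B') \<longleftrightarrow>
    (\<forall>C. circuit E I C \<longrightarrow> card (S \<inter> C) \<ge> card C - 1)"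
    (is "?ident \<longleftrightarrow> ?circ")
proof
  assume ident: ?ident
  show ?circ
  proof (intro allI impI, rule ccontr)
    fix C assume C: "circuit E I C" and small: "\<not> card (S \<inter> C) \<ge> card C - 1"
    have finC: "finite C"
      using C finite_ground finite_subset by (auto simp: circuit_def dependent_set_def)
    have "card (C - S) = card C - card (S \<inter> C)"
      using finC by (simp add: card_Diff_subset_Int Int_commute)
    \<comment> \<open>Failure of the bound means that at least two elements of \<open>C\<close> lie
      outside \<open>S\<close>.\<close>
    then have "\<not> card (C - S) \<le> Suc 0" using small by linarith
    then obtain e f where "e \<in> C - S" "f \<in> C - S" "e \<noteq> f"
      using finC by (auto simp: card_le_Suc0_iff_eq)
    then obtain B B' where "basis I B" "basis I B'" "e \<in> B' - B" "B' = insert e (B - {f})"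
      using circuit_exchange_bases[OF C] by blast
    moreover from this have "S \<inter> B = S \<inter> B'"
      using \<open>e \<in> C - S\<close> \<open>f \<in> C - S\<close> by blast
    ultimately show False using ident by blast
  qed
next
  assume circ: ?circ
  show ?ident
  proof (intro allI impI, rule ccontr)
    fix B B' assume B: "basis I B" and B': "basis I B'" and agree: "S \<inter> B = S \<inter> B'"
      and "B \<noteq> B'"
    have BI: "B \<in> I" and B'I: "B' \<in> I" using B B' by (auto simp: basis_def)
    obtain e where e: "e \<in> B" "e \<notin> B'"
      using B B' \<open>B \<noteq> B'\<close> unfolding basis_def by blast
    have "insert e B' \<notin> I" using e B' unfolding basis_def by blast
    moreover have "insert e B' \<subseteq> E" using e BI B'I indep_subset_ground by blast
    ultimately obtain C where C: "C \<subseteq> insert e B'" "circuit E I C"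
      using exists_circuit by blast
    have C_dep: "C \<notin> I" "C \<subseteq> E" using C by (auto simp: circuit_def dependent_set_def)
    \<comment> \<open>Otherwise \<open>C\<close> would lie in the independent set \<open>B'\<close>;
      likewise \<open>C\<close> cannot lie in \<open>B\<close>, which provides
      \<open>f\<close>.\<close>
    have eC: "e \<in> C" using C C_dep B'I indep_subset by blast
    obtain f where f: "f \<in> C" "f \<notin> B" using C_dep BI indep_subset by blast
    have "f \<in> B'" using f C e by blast
    have finC: "finite C" using C_dep finite_ground finite_subset by blast
    have "e \<noteq> f" using e f by blast
    then have card_ef: "card {e, f} = 2" by simp
    \<comment> \<open>Each of \<open>e\<close> and \<open>f\<close> lies in exactly one of the two
      bases, which agree on \<open>S\<close>.\<close>
    have "S \<inter> C \<subseteq> C - {e, f}" using agree e f \<open>f \<in> B'\<close> by blast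
    then have "card (S \<inter> C) \<le> card (C - {e, f})" using finC by (simp add: card_mono)
    also have "\<dots> = card C - 2"
      using eC f card_ef by (subst card_Diff_subset) auto
    finally have "card (S \<inter> C) \<le> card C - 2" .
    \<comment> \<open>Subtraction on naturals truncates: \<open>card C - 2 < card C - 1\<close>
      requires \<open>card C \<ge> 2\<close>.\<close>
    moreover have "card {e, f} \<le> card C" using eC f finC by (intro card_mono) auto
    ultimately show False using circ C(2) card_ef by fastforce
  qed
qed

section \<open>Incidence vectors of bases\<close>

lemma identifying_basis_vectors_iff:
  assumes SE: "S \<subseteq> E"
  shows "identifying (basis_vectors E I) S \<longleftrightarrow>
    (\<forall>B B'. basis I B \<longrightarrow> basis I B' \<longrightarrow> S \<inter> B = S \<inter> B' \<longrightarrow> B = B')"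
proof -
  have X_eq: "basis_vectors E I = incidence_vector E ` Collect (basis I)"
    unfolding basis_vectors_def by blast
  have agree: "(\<exists>e\<in>S. incidence_vector E B e \<noteq> incidence_vector E B' e) \<longleftrightarrow>
      S \<inter> B \<noteq> S \<inter> B'" if "S \<subseteq> E" for S B B'
    using that by (auto simp: incidence_vector_def indicator_def subset_iff split: if_splits)
  \<comment> \<open>Taking \<open>E\<close> itself for \<open>S\<close> in \<open>agree\<close>
    gives injectivity, because bases are subsets of \<open>E\<close>.\<close>
  have inj: "incidence_vector E B = incidence_vector E B' \<longleftrightarrow> B = B'"
    if "basis I B" "basis I B'" for B B'
    using agree[OF order_refl, of B B'] that indep_subset_ground
    unfolding basis_def by (metis Int_absorb1)
  show ?thesis
    unfolding identifying_def X_eq ball_simps agree[OF SE] using inj by auto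
qed

text \<open>The componentwise order on incidence vectors is inclusion of the bases, and a basis is
  maximal among independent sets.\<close>

lemma basis_vectors_antichain:
  assumes "x \<in> basis_vectors E I" "y \<in> basis_vectors E I" and le: "\<forall>e\<in>E. x e \<le> y e"
  shows "x = y"
proof -
  obtain B B' where B: "basis I B" "basis I B'"
    and xy: "x = incidence_vector E B" "y = incidence_vector E B'"
    using assms unfolding basis_vectors_def by blast
  have "B \<subseteq> E" using B indep_subset_ground by (auto simp: basis_def)
  then have "B \<subseteq> B'" using le
    by (force simp: xy incidence_vector_def indicator_def split: if_splits)
  then show ?thesis using B xy unfolding basis_def by blast
qed

lemma finite_basis_vectors: "finite (basis_vectors E I)"
proof -
  have "basis_vectors E I \<subseteq> incidence_vector E ` Pow E"
    unfolding basis_vectors_def basis_def using indep_subset_ground by blast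
  then show ?thesis using finite_ground by (meson finite_Pow_iff finite_imageI finite_subset)
qed

end

theorem theorem5p3:
  fixes E S :: "'a set" and I :: "'a set set"
    and X :: "('a \<Rightarrow> real) set" and \<C> :: "(('a \<Rightarrow> real) \<Rightarrow> real) set"
  assumes "matroid E I"
    and "X = basis_vectors E I"
    and "\<C> = nondecreasing_costs E X"
    and "S \<subseteq> E"
  shows "(controlling X \<C> S \<longleftrightarrow> identifying X S) \<and>
    (identifying X S \<longleftrightarrow> (\<forall>C. circuit E I C \<longrightarrow> card (S \<inter> C) \<ge> card C - 1))"
proof -
  interpret matroid E I by fact
  \<comment> \<open>With every cost function on \<open>X\<close> allowed, the indicator cost that
    separates two vectors becomes available.\<close>
  have costs: "\<C> = X \<rightarrow>\<^sub>E UNIV"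
    unfolding assms(3) by (rule nondecreasing_costs_antichain)
      (use assms(2) basis_vectors_antichain in blast)
  have "controlling X \<C> S" if "identifying X S"
  proof (rule finite_binary_identifying_imp_controlling[OF _ _ _ that])
    show "finite X" using finite_basis_vectors assms(2) by simp
    show "finite S" using assms(4) finite_ground finite_subset by blast
    show "x e \<in> {0, 1}" if "x \<in> X" "e \<in> S" for x e
      using that assms(2,4)
      by (auto simp: basis_vectors_def incidence_vector_def indicator_def)
  qed
  moreover have "identifying X S" if "controlling X \<C> S"
    using that costs controlling_all_costs_imp_identifying by blast
  moreover have "identifying X S \<longleftrightarrow> (\<forall>C. circuit E I C \<longrightarrow> card (S \<inter> C) \<ge> card C - 1)"
    unfolding assms(2) identifying_basis_vectors_iff[OF assms(4)]
    by (rule bases_identified_iff_circuits)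
  ultimately show ?thesis by blast
qed

end
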